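(* Let $n\ge 3$. As a sum of simple two-sided ideals, $$MM(D_{2n})=\mathbb{C}J\oplus\bigoplus_{j=1}^{\frac{n-1}{2}}MM(D_{2n})\,U_{\pi_2^j}\qquad\text{if } n \text{ is odd},$$ and $$MM(D_{2n})=\mathbb{C}J\oplus\mathbb{C}U_{\chi'}\oplus\bigoplus_{j=1}^{m-1}MM(D_{2n})\,U_{\pi_2^j}\qquad\text{if } n=2m.$$ The dimension of $MM(D_{2n})$ over $\mathbb{C}$ is $2n-1$ when $n$ is odd, and $2n-2$ when $n=2m$.
   Context: $D_{2n}$ is the dihedral group with $2n$ elements, realized as the subgroup of the symmetric group $S_n$ generated by the $n$-cycle $R=(1\,2\,\dots\,n)$ and the involution $C$ given by $C(i)=n+1-i$. For $\sigma\in S_n$, $P_\sigma$ is the $n\times n$ permutation matrix with $[P_\sigma]_{ba}=1$ if $\sigma(a)=b$ and $0$ otherwise. $MM(D_{2n})\subseteq M(n,\mathbb{C})$ is the associative algebra over $\mathbb{C}$ generated by the $P_\sigma$, $\sigma\in D_{2n}$ (equivalently, their complex linear span). $J$ is the $n\times n$ matrix with all entries $1$; $U_{\pi_2^j}=\frac2n\sum_{k=0}^{n-1}\cos(2kj\pi/n)P_{R^k}$, i.e. the matrix with $(a,b)$ entry $\frac2n\cos(2(a-b)j\pi/n)$; and, for $n$ even, $U_{\chi'}$ is the matrix with $(a,b)$ entry $\frac1n(-1)^{a+b}$. *)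

theory Defs
  imports
    Complex_Main
    "HOL-Algebra.Algebra"
    "Jordan_Normal_Form.VS_Connect"
begin

definition rotation :: "nat \<Rightarrow> nat \<Rightarrow> nat"
  where "rotation n = cycle_of_list [1..<n+1]"

definition reflection :: "nat \<Rightarrow> nat \<Rightarrow> nat"
  where "reflection n i = (if i \<in> {1..n} then n + 1 - i else i)"

definition dihedral :: "nat \<Rightarrow> (nat \<Rightarrow> nat) set"
  where "dihedral n = generate (sym_group n) {rotation n, reflection n}"

text \<open>Permutations act on \<open>{1..n}\<close>, whereas matrix positions are numbered from \<open>0\<close>:
  position \<open>(i, j)\<close> is the entry with row label \<open>i + 1\<close> and column label \<open>j + 1\<close>.\<close>

definition perm_mat :: "nat \<Rightarrow> (nat \<Rightarrow> nat) \<Rightarrow> complex mat"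
  where "perm_mat n \<sigma> = mat n n (\<lambda>(i, j). if \<sigma> (j + 1) = i + 1 then 1 else 0)"

inductive_set mat_alg_gen :: "nat \<Rightarrow> complex mat set \<Rightarrow> complex mat set"
  for n :: nat and S :: "complex mat set"
  where
    one: "1\<^sub>m n \<in> mat_alg_gen n S"
  | incl: "A \<in> S \<Longrightarrow> A \<in> mat_alg_gen n S"
  | smult: "A \<in> mat_alg_gen n S \<Longrightarrow> c \<cdot>\<^sub>m A \<in> mat_alg_gen n S"
  | add: "A \<in> mat_alg_gen n S \<Longrightarrow> B \<in> mat_alg_gen n S \<Longrightarrow> A + B \<in> mat_alg_gen n S"
  | mult: "A \<in> mat_alg_gen n S \<Longrightarrow> B \<in> mat_alg_gen n S \<Longrightarrow> A * B \<in> mat_alg_gen n S"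

text \<open>For square matrices the record \<^const>\<open>module_mat\<close> also carries the matrix product
  and the identity matrix, so \<open>MM n\<close> can be used both as a ring and as a complex
  vector space.\<close>

definition MM :: "nat \<Rightarrow> (complex, complex mat) module"
  where "MM n = (module_mat TYPE(complex) n n)
    \<lparr>carrier := mat_alg_gen n (perm_mat n ` dihedral n)\<rparr>"

definition mat_J :: "nat \<Rightarrow> complex mat"
  where "mat_J n = mat n n (\<lambda>_. 1)"

definition U_rot :: "nat \<Rightarrow> nat \<Rightarrow> complex mat"
  where "U_rot n j = complex_of_real (2 / real n) \<cdot>\<^sub>m
    finsum (module_mat TYPE(complex) n n)
      (\<lambda>k. complex_of_real (cos (2 * real k * real j * pi / real n)) \<cdot>\<^sub>m perm_mat n (rotation n ^^ k))
      {0..<n}"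

definition U_alt :: "nat \<Rightarrow> complex mat"
  where "U_alt n = mat n n (\<lambda>(i, j). complex_of_real (1 / real n) * (- 1) ^ ((i + 1) + (j + 1)))"

text \<open>\<open>MM n\<close> contains all scalar matrices, so its two-sided ring ideals are automatically complex
  subspaces.\<close>

definition simple_ideal :: "'a set \<Rightarrow> ('a, 'b) ring_scheme \<Rightarrow> bool"
  where "simple_ideal I R \<longleftrightarrow> ideal I R \<and> I \<noteq> {\<zero>\<^bsub>R\<^esub>} \<and>
    (\<forall>I'. ideal I' R \<and> I' \<subseteq> I \<longrightarrow> I' = {\<zero>\<^bsub>R\<^esub>} \<or> I' = I)"

definition internal_direct_sum :: "('a, 'b) ring_scheme \<Rightarrow> 'k set \<Rightarrow> ('k \<Rightarrow> 'a set) \<Rightarrow> bool"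
  where "internal_direct_sum R K I \<longleftrightarrow> finite K \<and> (\<forall>k\<in>K. additive_subgroup (I k) R) \<and>
    (\<forall>a\<in>carrier R. \<exists>!x. x \<in> (\<Pi>\<^sub>E k\<in>K. I k) \<and> a = finsum R x K)"

datatype block = Triv | Alt | Rot nat

text \<open>\<open>PIdl\<^bsub>R\<^esub> a\<close> is by definition \<open>{x \<otimes>\<^bsub>R\<^esub> a | x. x \<in> carrier R}\<close>, the set \<open>R a\<close>;
  the constant carries no assumption of commutativity.\<close>

primrec MM_block :: "nat \<Rightarrow> block \<Rightarrow> complex mat set"
  where
    "MM_block n Triv = range (\<lambda>c. c \<cdot>\<^sub>m mat_J n)"
  | "MM_block n Alt = range (\<lambda>c. c \<cdot>\<^sub>m U_alt n)"
  | "MM_block n (Rot j) = PIdl\<^bsub>MM n\<^esub> (U_rot n j)"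

end

theory Submission
  imports Defs "HOL-Number_Theory.Cong"
begin

text \<open>The discrete Fourier transform turns the algebra into block matrices. Let \<open>\<omega>\<close> be a primitive
  \<open>n\<close>-th root of unity and let \<open>F\<close> be the matrix with entries \<open>\<omega>\<^sup>a\<^sup>p\<close>. Conjugation by \<open>F\<close> makes a power
  of \<open>R\<close> diagonal, because the columns of \<open>F\<close> are the characters of the cyclic group, and it makes
  a reflection live on the positions \<open>(p, q)\<close> with \<open>p + q \<equiv> 0\<close> modulo \<open>n\<close>, because a reflection inverts the
  characters. So \<open>F\<^sup>-\<^sup>1 A F\<close> vanishes off the positions \<open>(p, q)\<close> with \<open>q \<equiv> \<plusminus>p\<close> for every \<open>A\<close> in the algebra.
  Conversely, averaging the powers of \<open>R\<close> against a character gives every diagonal matrix unit, and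
  multiplying these by \<open>C\<close> gives, up to a scalar, every matrix unit at \<open>(p, -p)\<close>. Hence the algebra
  consists of all matrices whose Fourier coordinates are supported on the equivalence
  relation \<open>q \<equiv> \<plusminus>p\<close> (\<open>mat_alg_gen_dihedral\<close>).

  An equivalence relation has this effect in general: the matrices supported on it form a direct sum,
  over the classes \<open>c\<close>, of full matrix algebras of size \<open>|c|\<close>; each summand is a simple two-sided ideal,
  and the dimension is the sum of the \<open>|c|\<^sup>2\<close> (\<open>blocks_direct_sum\<close>, \<open>block_simple\<close>, \<open>dim_supp_alg\<close>).

  The classes of \<open>q \<equiv> \<plusminus>p\<close> are \<open>{0}\<close>, the pairs \<open>{j, n - j}\<close>, and \<open>{n / 2}\<close> when \<open>n\<close> is even. In
  Fourier coordinates \<open>J\<close> is a multiple of the matrix unit at \<open>(0, 0)\<close>, \<open>U\<^sub>\<chi>'\<close> is the matrix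
  unit at \<open>(n / 2, n / 2)\<close>, and \<open>U\<^sub>j\<close> is the identity of the block \<open>{j, n - j}\<close>, so these elements
  generate exactly the blocks (\<open>MM_block_eq\<close>).\<close>

section \<open>Matrices with prescribed support in another basis\<close>

text \<open>\<open>F\<close> is the matrix of a change of basis and \<open>G\<close> its inverse. Nothing in the block structure depends on
  which basis diagonalises the blocks, so the Fourier matrix enters only later.\<close>

locale change_of_basis =
  fixes n :: nat and F G :: "'a :: field mat"
  assumes F_carrier: "F \<in> carrier_mat n n"
    and G_carrier: "G \<in> carrier_mat n n"
    and FG: "F * G = 1\<^sub>m n"
    and GF: "G * F = 1\<^sub>m n"
begin

definition coords :: "'a mat \<Rightarrow> 'a mat"
  where "coords A = G * A * F"

definition from_coords :: "'a mat \<Rightarrow> 'a mat"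
  where "from_coords B = F * B * G"

text \<open>The matrix that becomes the matrix unit at \<open>(p, q)\<close> after the change of basis.\<close>

definition mat_unit :: "nat \<Rightarrow> nat \<Rightarrow> 'a mat"
  where "mat_unit p q = from_coords (mat n n (\<lambda>ij. if ij = (p, q) then 1 else 0))"

definition supported :: "(nat \<times> nat) set \<Rightarrow> 'a mat set"
  where "supported S = {A \<in> carrier_mat n n.
    \<forall>p<n. \<forall>q<n. coords A $$ (p, q) \<noteq> 0 \<longrightarrow> (p, q) \<in> S}"

text \<open>This has the same record shape as the dihedral matrix algebra, so that it serves as a ring and as a
  vector space, and the two can be identified by an equation.\<close>

definition supp_alg :: "(nat \<times> nat) set \<Rightarrow> ('a, 'a mat) module"
  where "supp_alg S = (module_mat TYPE('a) n n)\<lparr>carrier := supported S\<rparr>"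

lemma supp_alg_simps [simp]:
  "carrier (supp_alg S) = supported S"
  "monoid.mult (supp_alg S) = (*)"
  "ring.add (supp_alg S) = (+)"
  "monoid.one (supp_alg S) = 1\<^sub>m n"
  "ring.zero (supp_alg S) = 0\<^sub>m n n"
  "module.smult (supp_alg S) = (\<cdot>\<^sub>m)"
  by (simp_all add: supp_alg_def module_mat_def)

lemma square_mult_carrier [simp]:
  "A \<in> carrier_mat n n \<Longrightarrow> B \<in> carrier_mat n n \<Longrightarrow> A * B \<in> carrier_mat n n"
  by (rule mult_carrier_mat)

lemma square_mult_assoc:
  "A \<in> carrier_mat n n \<Longrightarrow> B \<in> carrier_mat n n \<Longrightarrow> C \<in> carrier_mat n n \<Longrightarrow>
    A * B * C = A * (B * C)"
  by (rule assoc_mult_mat)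

lemma square_mult_distrib:
  fixes A B C :: "'a mat"
  assumes "A \<in> carrier_mat n n" "B \<in> carrier_mat n n" "C \<in> carrier_mat n n"
  shows "A * (B + C) = A * B + A * C" "(A + B) * C = A * C + B * C"
    "A * (a \<cdot>\<^sub>m B) = a \<cdot>\<^sub>m (A * B)" "(a \<cdot>\<^sub>m A) * B = a \<cdot>\<^sub>m (A * B)"
  by (rule mult_add_distrib_mat[OF assms] add_mult_distrib_mat[OF assms]
      mult_smult_distrib[OF assms(1,2)] mult_smult_assoc_mat[OF assms(1,2)])+

lemma coords_carrier [simp]: "A \<in> carrier_mat n n \<Longrightarrow> coords A \<in> carrier_mat n n"
  by (simp add: coords_def F_carrier G_carrier)

lemma from_coords_carrier [simp]: "A \<in> carrier_mat n n \<Longrightarrow> from_coords A \<in> carrier_mat n n"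
  by (simp add: from_coords_def F_carrier G_carrier)

lemma coords_from_coords [simp]:
  assumes A: "A \<in> carrier_mat n n"
  shows "coords (from_coords A) = A"
proof -
  have "coords (from_coords A) = (G * F) * A * (G * F)"
    unfolding coords_def from_coords_def using A F_carrier G_carrier
    by (simp add: square_mult_assoc)
  then show ?thesis using A GF by simp
qed

lemma from_coords_coords [simp]:
  assumes A: "A \<in> carrier_mat n n"
  shows "from_coords (coords A) = A"
proof -
  have "from_coords (coords A) = (F * G) * A * (F * G)"
    unfolding coords_def from_coords_def using A F_carrier G_carrier
    by (simp add: square_mult_assoc)
  then show ?thesis using A FG by simp
qed

lemma coords_mult:
  assumes A: "A \<in> carrier_mat n n" and B: "B \<in> carrier_mat n n"
  shows "coords (A * B) = coords A * coords B"
proof -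
  have "coords A * coords B = G * A * (F * G) * B * F"
    unfolding coords_def using A B F_carrier G_carrier
    by (simp add: square_mult_assoc)
  also have "\<dots> = G * (A * B) * F"
    unfolding FG using A B F_carrier G_carrier
    by (simp add: square_mult_assoc)
  finally show ?thesis by (simp add: coords_def)
qed

lemma coords_add:
  assumes A: "A \<in> carrier_mat n n" and B: "B \<in> carrier_mat n n"
  shows "coords (A + B) = coords A + coords B"
  unfolding coords_def using A B F_carrier G_carrier
  by (simp add: square_mult_distrib)

lemma coords_smult:
  assumes A: "A \<in> carrier_mat n n"
  shows "coords (a \<cdot>\<^sub>m A) = a \<cdot>\<^sub>m coords A"
  unfolding coords_def using A F_carrier G_carrier
  by (simp add: square_mult_distrib)

lemma coords_zero: "coords (0\<^sub>m n n) = 0\<^sub>m n n"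
  unfolding coords_def using F_carrier G_carrier by simp

lemma coords_one: "coords (1\<^sub>m n) = 1\<^sub>m n"
  unfolding coords_def using F_carrier G_carrier GF by simp

lemma coords_eqI:
  assumes "A \<in> carrier_mat n n" "B \<in> carrier_mat n n"
    and "\<And>p q. p < n \<Longrightarrow> q < n \<Longrightarrow> coords A $$ (p, q) = coords B $$ (p, q)"
  shows "A = B"
proof -
  have "coords A = coords B"
    by (rule eq_matI)
      (use assms(3) carrier_matD[OF coords_carrier[OF assms(1)]]
        carrier_matD[OF coords_carrier[OF assms(2)]] in simp_all)
  then have "from_coords (coords A) = from_coords (coords B)" by simp
  then show ?thesis using assms(1,2) by simp
qed

lemma index_coords_add:
  assumes "A \<in> carrier_mat n n" "B \<in> carrier_mat n n" "p < n" "q < n"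
  shows "coords (A + B) $$ (p, q) = coords A $$ (p, q) + coords B $$ (p, q)"
  using assms carrier_matD[OF coords_carrier[OF assms(2)]] by (simp add: coords_add)

lemma index_coords_smult:
  assumes "A \<in> carrier_mat n n" "p < n" "q < n"
  shows "coords (a \<cdot>\<^sub>m A) $$ (p, q) = a * coords A $$ (p, q)"
  using assms carrier_matD[OF coords_carrier[OF assms(1)]] by (simp add: coords_smult)

lemma index_coords_mult:
  assumes "A \<in> carrier_mat n n" "B \<in> carrier_mat n n" "p < n" "q < n"
  shows "coords (A * B) $$ (p, q) = (\<Sum>r<n. coords A $$ (p, r) * coords B $$ (r, q))"
  using assms carrier_matD[OF coords_carrier[OF assms(1)]] carrier_matD[OF coords_carrier[OF assms(2)]]
  by (simp add: coords_mult scalar_prod_def atLeast0LessThan)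

lemma mat_unit_carrier [simp]: "mat_unit p q \<in> carrier_mat n n"
  by (simp add: mat_unit_def)

lemma index_coords_mat_unit:
  "i < n \<Longrightarrow> j < n \<Longrightarrow> coords (mat_unit p q) $$ (i, j) = (if i = p \<and> j = q then 1 else 0)"
  by (simp add: mat_unit_def)

lemma supported_carrier: "A \<in> supported S \<Longrightarrow> A \<in> carrier_mat n n"
  by (simp add: supported_def)

lemma supportedD:
  "A \<in> supported S \<Longrightarrow> p < n \<Longrightarrow> q < n \<Longrightarrow> (p, q) \<notin> S \<Longrightarrow> coords A $$ (p, q) = 0"
  by (auto simp: supported_def)

lemma supportedI:
  assumes "A \<in> carrier_mat n n"
    and "\<And>p q. p < n \<Longrightarrow> q < n \<Longrightarrow> (p, q) \<notin> S \<Longrightarrow> coords A $$ (p, q) = 0"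
  shows "A \<in> supported S"
  using assms by (auto simp: supported_def)

lemma supported_mono: "S \<subseteq> T \<Longrightarrow> supported S \<subseteq> supported T"
  by (auto simp: supported_def)

lemma mat_unit_supported: "(p, q) \<in> S \<Longrightarrow> mat_unit p q \<in> supported S"
  by (rule supportedI) (auto simp: index_coords_mat_unit)

lemma zero_supported: "0\<^sub>m n n \<in> supported S"
  by (rule supportedI) (auto simp: coords_zero)

lemma add_supported: "A \<in> supported S \<Longrightarrow> B \<in> supported S \<Longrightarrow> A + B \<in> supported S"
  by (rule supportedI)
    (auto simp: index_coords_add supported_carrier supportedD)

lemma smult_supported: "A \<in> supported S \<Longrightarrow> a \<cdot>\<^sub>m A \<in> supported S"
  by (rule supportedI) (auto simp: index_coords_smult supported_carrier supportedD)

text \<open>A nonzero entry of a product at \<open>(p, r)\<close> needs some \<open>q\<close> with nonzero entries of the factors at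
  \<open>(p, q)\<close> and \<open>(q, r)\<close>; supports therefore compose like relations.\<close>

lemma mult_supported:
  assumes A: "A \<in> supported S" and B: "B \<in> supported T" 
    and ST: "\<And>p q r. (p, q) \<in> S \<Longrightarrow> (q, r) \<in> T \<Longrightarrow> (p, r) \<in> U"
  shows "A * B \<in> supported U"
proof (rule supportedI)
  show "A * B \<in> carrier_mat n n" using A B by (auto simp: supported_def)
  fix p r assume pr: "p < n" "r < n" "(p, r) \<notin> U"
  have "coords A $$ (p, q) * coords B $$ (q, r) = 0" if "q < n" for q
    using supportedD[OF A] supportedD[OF B] ST pr that by (metis mult_zero_left mult_zero_right)
  then have "(\<Sum>q<n. coords A $$ (p, q) * coords B $$ (q, r)) = 0"
    by (intro sum.neutral) auto
  then show "coords (A * B) $$ (p, r) = 0"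
    using pr A B by (simp add: index_coords_mult supported_carrier)
qed

lemma one_supported:
  assumes "\<And>p. p < n \<Longrightarrow> (p, p) \<in> S"
  shows "1\<^sub>m n \<in> supported S"
  by (rule supportedI) (use assms in \<open>auto simp: coords_one\<close>)

lemma abelian_group_supp_alg: "abelian_group (supp_alg S)"
proof (rule abelian_groupI, simp_all)
  fix A assume A: "A \<in> supported S"
  then show "\<exists>B\<in>supported S. B + A = 0\<^sub>m n n"
    by (intro bexI[of _ "(- 1) \<cdot>\<^sub>m A"] smult_supported)
      (auto simp: supported_def intro!: eq_matI)
qed (auto simp: zero_supported add_supported supported_carrier
    intro: comm_add_mat[of _ n n] assoc_add_mat[of _ n n])

lemma vectorspace_supp_alg: "vectorspace class_ring (supp_alg S)"
proof -
  interpret abelian_group "supp_alg S" by (rule abelian_group_supp_alg)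
  show ?thesis
    by (unfold_locales, unfold supp_alg_simps class_ring_simps)
      (auto simp: smult_supported add_smult_distrib_left_mat[of _ n n] add_smult_distrib_right_mat[of _ n n] supported_def
        index_coords_smult)
qed

lemma coords_finsum:
  assumes "finite Y" and f: "f \<in> Y \<rightarrow> supported S" and "p < n" "q < n"
  shows "coords (finsum (supp_alg S) f Y) $$ (p, q) = (\<Sum>x\<in>Y. coords (f x) $$ (p, q))"
  using \<open>finite Y\<close> f
proof induction
  case empty
  interpret abelian_group "supp_alg S" by (rule abelian_group_supp_alg)
  show ?case using assms(3,4) by (simp add: coords_zero)
next
  case (insert x Y)
  interpret abelian_group "supp_alg S" by (rule abelian_group_supp_alg)
  have "finsum (supp_alg S) f Y \<in> supported S"
    using finsum_closed[of f Y] insert.prems by auto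
  moreover have "f x \<in> supported S" using insert.prems by auto
  ultimately show ?case
    using insert assms(3,4) by (simp add: index_coords_add[OF supported_carrier supported_carrier])
qed

text \<open>Every matrix is the sum of its coordinates times matrix units. Stated as closure of a set \<open>T\<close>,
  this gives spanning sets, ideals and generated algebras from their matrix units alone.\<close>

lemma supported_induct:
  assumes A: "A \<in> supported S" and S: "S \<subseteq> {..<n} \<times> {..<n}"
    and zero: "0\<^sub>m n n \<in> T"
    and add: "\<And>B C. B \<in> T \<Longrightarrow> C \<in> T \<Longrightarrow> B + C \<in> T"
    and step: "\<And>p q. (p, q) \<in> S \<Longrightarrow> coords A $$ (p, q) \<cdot>\<^sub>m mat_unit p q \<in> T"
  shows "A \<in> T"
proof -
  let ?summand = "\<lambda>pq. coords A $$ pq \<cdot>\<^sub>m mat_unit (fst pq) (snd pq)"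
  interpret abelian_group "supp_alg S" by (rule abelian_group_supp_alg)
  have fin: "finite S" using S by (rule finite_subset) simp
  have summand: "?summand \<in> S \<rightarrow> supported S"
    by (auto intro!: smult_supported mat_unit_supported)
  have in_T: "finsum (supp_alg S) ?summand Y \<in> T" if "finite Y" "Y \<subseteq> S" for Y
    using that
  proof induction
    case empty
    then show ?case using zero by simp
  next
    case (insert x Y)
    have "?summand \<in> Y \<rightarrow> supported S" "?summand x \<in> supported S" using summand insert.prems by auto
    then show ?case using insert step[of "fst x" "snd x"] add by simp
  qed
  have "A = finsum (supp_alg S) ?summand S"
  proof (rule coords_eqI)
    show "finsum (supp_alg S) ?summand S \<in> carrier_mat n n"
      using finsum_closed[of ?summand S] summand supported_carrier by auto
    fix p q assume pq: "p < n" "q < n"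
    have "coords (finsum (supp_alg S) ?summand S) $$ (p, q) = (\<Sum>x\<in>S. coords (?summand x) $$ (p, q))"
      by (rule coords_finsum[OF fin summand pq])
    also have "\<dots> = (\<Sum>x\<in>S. if x = (p, q) then coords A $$ x else 0)"
      by (rule sum.cong) (use pq in \<open>auto simp: index_coords_smult index_coords_mat_unit\<close>)
    also have "\<dots> = coords A $$ (p, q)"
      using fin supportedD[OF A pq] by (simp add: sum.delta)
    finally show "coords A $$ (p, q) = coords (finsum (supp_alg S) ?summand S) $$ (p, q)" ..
  qed (use A supported_carrier in auto)
  then show ?thesis using in_T[OF fin] by simp
qed

lemma supported_singleton: "supported {(p, q)} = range (\<lambda>a. a \<cdot>\<^sub>m mat_unit p q)"
proof
  show "supported {(p, q)} \<subseteq> range (\<lambda>a. a \<cdot>\<^sub>m mat_unit p q)"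
  proof
    fix A assume A: "A \<in> supported {(p, q)}"
    have "A = coords A $$ (p, q) \<cdot>\<^sub>m mat_unit p q"
      by (rule coords_eqI)
        (use supportedD[OF A] supported_carrier[OF A] in
          \<open>auto simp: index_coords_smult index_coords_mat_unit\<close>)
    then show "A \<in> range (\<lambda>a. a \<cdot>\<^sub>m mat_unit p q)" by blast
  qed
  show "range (\<lambda>a. a \<cdot>\<^sub>m mat_unit p q) \<subseteq> supported {(p, q)}"
    by (auto intro: smult_supported mat_unit_supported)
qed

lemma mat_unit_inj: "inj_on (\<lambda>(p, q). mat_unit p q) ({..<n} \<times> {..<n})"
proof (rule inj_onI, clarsimp)
  fix p q p' q' assume "p < n" "q < n" "mat_unit p q = mat_unit p' q'"
  then show "p = p' \<and> q = q'"
    using index_coords_mat_unit[of p q p q] index_coords_mat_unit[of p q p' q'] by (auto split: if_splits)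
qed

text \<open>The matrix units at the positions of \<open>S\<close> are a basis: they span by the expansion above, and the
  coordinate at \<open>(p, q)\<close> of a linear combination is the coefficient of the unit at \<open>(p, q)\<close>.\<close>

lemma dim_supp_alg:
  assumes S: "S \<subseteq> {..<n} \<times> {..<n}"
  shows "vectorspace.fin_dim class_ring (supp_alg S)"
    and "vectorspace.dim class_ring (supp_alg S) = card S"
proof -
  interpret vectorspace class_ring "supp_alg S" by (rule vectorspace_supp_alg)
  let ?U = "(\<lambda>(p, q). mat_unit p q) ` S"
  have finS: "finite S" using S by (rule finite_subset) simp
  have inj: "inj_on (\<lambda>(p, q). mat_unit p q) S" using mat_unit_inj S by (rule inj_on_subset)
  have U: "?U \<subseteq> carrier (supp_alg S)" by (auto simp: mat_unit_supported)
  have "submodule class_ring (span ?U) (supp_alg S)" by (rule span_is_submodule[OF U])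
  then interpret span: submodule class_ring "span ?U" "supp_alg S" .
  have gen: "span ?U = carrier (supp_alg S)"
  proof
    show "span ?U \<subseteq> carrier (supp_alg S)" by (rule span_is_subset2[OF U])
    show "carrier (supp_alg S) \<subseteq> span ?U"
    proof
      fix A assume A: "A \<in> carrier (supp_alg S)"
      show "A \<in> span ?U"
      proof (rule supported_induct[OF A[simplified] S])
        fix p q assume "(p, q) \<in> S"
        then have "mat_unit p q \<in> span ?U" using in_own_span[OF U] by force
        then show "coords A $$ (p, q) \<cdot>\<^sub>m mat_unit p q \<in> span ?U"
          using span.smult_closed by simp
      qed (use span_zero span.m_closed in simp_all)
    qed
  qed
  have indpt: "lin_indpt ?U"
  proof (rule finite_lin_indpt2)
    show "finite ?U" using finS by simp
    show "?U \<subseteq> carrier (supp_alg S)" by (rule U)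
    fix a :: "'a mat \<Rightarrow> 'a"
    assume "lincomb a ?U = \<zero>\<^bsub>supp_alg S\<^esub>"
    then have lc: "finsum (supp_alg S) (\<lambda>v. a v \<cdot>\<^sub>m v) ?U = 0\<^sub>m n n"
      by (simp add: lincomb_def)
    have maps: "(\<lambda>v. a v \<cdot>\<^sub>m v) \<in> ?U \<rightarrow> supported S"
      using U by (auto intro: smult_supported)
    show "\<forall>v\<in>?U. a v = \<zero>\<^bsub>class_ring\<^esub>"
    proof clarsimp
      fix p q assume pq: "(p, q) \<in> S"
      then have pq_n: "p < n" "q < n" using S by auto
      have "0 = coords (finsum (supp_alg S) (\<lambda>v. a v \<cdot>\<^sub>m v) ?U) $$ (p, q)"
        using lc pq_n by (simp add: coords_zero)
      also have "\<dots> = (\<Sum>v\<in>?U. coords (a v \<cdot>\<^sub>m v) $$ (p, q))"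
        using finS by (intro coords_finsum[OF _ maps pq_n]) simp
      also have "\<dots> = (\<Sum>x\<in>S. coords (a (mat_unit (fst x) (snd x)) \<cdot>\<^sub>m mat_unit (fst x) (snd x)) $$ (p, q))"
        using sum.reindex[OF inj] by (simp add: case_prod_beta)
      also have "\<dots> = (\<Sum>x\<in>S. if x = (p, q) then a (mat_unit p q) else 0)"
        by (rule sum.cong) (use pq_n in \<open>auto simp: index_coords_smult index_coords_mat_unit\<close>)
      also have "\<dots> = a (mat_unit p q)" using finS pq by simp
      finally show "a (mat_unit p q) = 0" ..
    qed
  qed
  have "basis ?U" using gen indpt U by (simp add: basis_def)
  then show "dim = card S" using dim_basis[of ?U] finS inj by (simp add: card_image)
  show "fin_dim" unfolding fin_dim_def using gen U finS by blast
qed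

end

section \<open>The block decomposition given by a partition\<close>

locale block_algebra = change_of_basis n F G
  for n :: nat and F G :: "'a :: field mat" +
  fixes K :: "'k set" and c :: "'k \<Rightarrow> nat set"
  assumes finite_K: "finite K"
    and cover: "(\<Union>k\<in>K. c k) = {..<n}"
    and disjoint: "\<And>k l p. k \<in> K \<Longrightarrow> l \<in> K \<Longrightarrow> p \<in> c k \<Longrightarrow> p \<in> c l \<Longrightarrow> k = l"
begin

definition blocks :: "(nat \<times> nat) set"
  where "blocks = (\<Union>k\<in>K. c k \<times> c k)"

abbreviation R :: "('a, 'a mat) module"
  where "R \<equiv> supp_alg blocks"

lemma class_subset: "k \<in> K \<Longrightarrow> c k \<subseteq> {..<n}"
  using cover by blast

lemma finite_class: "k \<in> K \<Longrightarrow> finite (c k)"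
  using class_subset finite_subset by blast

lemma blocks_subset: "blocks \<subseteq> {..<n} \<times> {..<n}"
  unfolding blocks_def using class_subset by blast

lemma blocks_refl: "p < n \<Longrightarrow> (p, p) \<in> blocks"
  unfolding blocks_def using cover by blast

lemma block_subset_blocks: "k \<in> K \<Longrightarrow> c k \<times> c k \<subseteq> blocks"
  unfolding blocks_def by blast

lemma blocks_classD: "(p, q) \<in> blocks \<Longrightarrow> k \<in> K \<Longrightarrow> p \<in> c k \<longleftrightarrow> q \<in> c k"
  unfolding blocks_def using disjoint by blast

lemma blocks_trans: "(p, q) \<in> blocks \<Longrightarrow> (q, r) \<in> blocks \<Longrightarrow> (p, r) \<in> blocks"
  unfolding blocks_def using disjoint by blast

lemma card_blocks: "card blocks = (\<Sum>k\<in>K. card (c k) ^ 2)"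
proof -
  have "card blocks = (\<Sum>k\<in>K. card (c k \<times> c k))"
    unfolding blocks_def
    by (rule card_UN_disjoint) (use finite_K finite_class disjoint in auto)
  then show ?thesis by (simp add: card_cartesian_product power2_eq_square)
qed

lemma ring_R: "ring R"
proof (rule ringI)
  show "abelian_group R" by (rule abelian_group_supp_alg)
  show "Group.monoid R"
    by (rule monoidI)
      (auto simp: one_supported blocks_refl supported_carrier
        intro: mult_supported[OF _ _ blocks_trans] assoc_mult_mat[OF supported_carrier supported_carrier supported_carrier]
          left_mult_one_mat[OF supported_carrier] right_mult_one_mat[OF supported_carrier])
qed (simp_all add: square_mult_distrib supported_carrier)

lemma subgroup_supported:
  assumes "S \<subseteq> blocks"
  shows "additive_subgroup (supported S) R"
proof (rule additive_subgroupI)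
  interpret ring R by (rule ring_R)
  show "subgroup (supported S) (add_monoid R)"
  proof (rule add.subgroupI, simp_all)
    show "supported S \<subseteq> supported blocks" using assms by (rule supported_mono)
    show "supported S \<noteq> {}" using zero_supported by blast
    fix A assume A: "A \<in> supported S"
    have Ab: "A \<in> supported blocks" using A supported_mono[OF assms] by blast
    have "(- 1) \<cdot>\<^sub>m A = \<ominus>\<^bsub>R\<^esub> A"
      by (rule minus_equality[symmetric])
        (use Ab supported_carrier[OF A] in \<open>auto intro!: eq_matI smult_supported\<close>)
    then show "\<ominus>\<^bsub>R\<^esub> A \<in> supported S" using smult_supported[OF A] by metis
  qed (auto intro: add_supported)
qed

text \<open>A class is closed under the relation, so neither left nor right multiplication by the algebra
  leaves its block.\<close>

lemma block_ideal:
  assumes k: "k \<in> K"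
  shows "ideal (supported (c k \<times> c k)) R"
proof (rule idealI)
  show "ring R" by (rule ring_R)
  show "subgroup (supported (c k \<times> c k)) (add_monoid R)"
    using subgroup_supported[OF block_subset_blocks[OF k]] by (simp add: additive_subgroup_def)
  fix A Y assume AX: "A \<in> supported (c k \<times> c k)" "Y \<in> carrier R"
  show "Y \<otimes>\<^bsub>R\<^esub> A \<in> supported (c k \<times> c k)" "A \<otimes>\<^bsub>R\<^esub> Y \<in> supported (c k \<times> c k)"
    using mult_supported[of _ blocks _ "c k \<times> c k" "c k \<times> c k"]
      mult_supported[of _ "c k \<times> c k" _ blocks "c k \<times> c k"] AX blocks_classD[OF _ k]
    by auto
qed

text \<open>Sandwiching between matrix units isolates a single coordinate of \<open>A\<close> and moves it to any
  prescribed position. This is why full matrix algebras are simple.\<close>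

lemma mat_unit_mult_mat_unit:
  assumes A: "A \<in> carrier_mat n n" and "p < n" "q < n"
  shows "mat_unit r p * A * mat_unit q s = coords A $$ (p, q) \<cdot>\<^sub>m mat_unit r s"
proof (rule coords_eqI)
  fix i j assume ij: "i < n" "j < n"
  have "coords (mat_unit r p * A * mat_unit q s) $$ (i, j)
      = (\<Sum>y<n. (\<Sum>x<n. coords (mat_unit r p) $$ (i, x) * coords A $$ (x, y)) * coords (mat_unit q s) $$ (y, j))"
    using A ij by (simp add: index_coords_mult[of _ _ i])
  also have "\<dots> = (\<Sum>y<n. \<Sum>x<n. if x = p then (if y = q then
      (if i = r \<and> j = s then coords A $$ (p, q) else 0) else 0) else 0)"
    unfolding sum_distrib_right
    by (intro sum.cong refl) (use ij in \<open>auto simp: index_coords_mat_unit\<close>)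
  also have "\<dots> = (if i = r \<and> j = s then coords A $$ (p, q) else 0)"
    using assms by simp
  finally show "coords (mat_unit r p * A * mat_unit q s) $$ (i, j)
      = coords (coords A $$ (p, q) \<cdot>\<^sub>m mat_unit r s) $$ (i, j)"
    using ij by (simp add: index_coords_smult index_coords_mat_unit)
qed (use A in \<open>auto simp:\<close>)

text \<open>An element whose coordinates form the identity of a block acts on the right as the projection
  onto that block.\<close>

lemma block_principal:
  assumes k: "k \<in> K" and U: "U \<in> carrier_mat n n"
    and coords_U: "\<And>p q. p < n \<Longrightarrow> q < n \<Longrightarrow>
      coords U $$ (p, q) = (if p = q \<and> p \<in> c k then 1 else 0)"
  shows "PIdl\<^bsub>R\<^esub> U = supported (c k \<times> c k)"
proof
  have U_block: "U \<in> supported (c k \<times> c k)"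
    using U by (rule supportedI) (auto simp: coords_U)
  show "PIdl\<^bsub>R\<^esub> U \<subseteq> supported (c k \<times> c k)"
    using ideal.I_l_closed[OF block_ideal[OF k] U_block] by (auto simp: cgenideal_def)
  show "supported (c k \<times> c k) \<subseteq> PIdl\<^bsub>R\<^esub> U"
  proof
    fix A assume A: "A \<in> supported (c k \<times> c k)"
    have "A = A * U"
    proof (rule coords_eqI)
      fix p q assume pq: "p < n" "q < n"
      have "coords (A * U) $$ (p, q) = (\<Sum>r<n. if r = q then (if q \<in> c k then coords A $$ (p, q) else 0) else 0)"
        unfolding index_coords_mult[OF supported_carrier[OF A] U pq]
        by (rule sum.cong) (use pq in \<open>auto simp: coords_U\<close>)
      then show "coords A $$ (p, q) = coords (A * U) $$ (p, q)"
        using pq supportedD[OF A pq] by auto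
    qed (use A U supported_carrier in auto)
    moreover have "A \<in> carrier R" using A supported_mono[OF block_subset_blocks[OF k]] by auto
    ultimately show "A \<in> PIdl\<^bsub>R\<^esub> U" unfolding cgenideal_def by auto
  qed
qed

text \<open>A nonzero \<open>A\<close> in an ideal inside the block has a nonzero coordinate at some \<open>(p, q)\<close>, necessarily in
  the class. Sandwiching \<open>A\<close> puts every matrix unit of the block into the ideal.\<close>

lemma block_simple:
  assumes k: "k \<in> K" and nonempty: "c k \<noteq> {}"
  shows "simple_ideal (supported (c k \<times> c k)) R"
  unfolding simple_ideal_def
proof (intro conjI allI impI)
  show "ideal (supported (c k \<times> c k)) R" by (rule block_ideal[OF k])
  obtain p where p: "p \<in> c k" using nonempty by blast
  then have pn: "p < n" using class_subset[OF k] by blast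
  have "mat_unit p p \<in> supported (c k \<times> c k)" using p by (simp add: mat_unit_supported)
  moreover have "mat_unit p p \<noteq> 0\<^sub>m n n"
  proof
    assume "mat_unit p p = 0\<^sub>m n n"
    then show False using index_coords_mat_unit[OF pn pn, of p p] pn by (simp add: coords_zero)
  qed
  ultimately show "supported (c k \<times> c k) \<noteq> {\<zero>\<^bsub>R\<^esub>}" by auto
next
  fix I assume I: "ideal I R \<and> I \<subseteq> supported (c k \<times> c k)"
  then interpret I: ideal I R by blast
  have I_zero: "0\<^sub>m n n \<in> I" and I_add: "A \<in> I \<Longrightarrow> B \<in> I \<Longrightarrow> A + B \<in> I" for A B
    using additive_subgroup.zero_closed[OF I.is_additive_subgroup]
      additive_subgroup.a_closed[OF I.is_additive_subgroup] by simp_all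
  show "I = {\<zero>\<^bsub>R\<^esub>} \<or> I = supported (c k \<times> c k)"
  proof (cases "I \<subseteq> {0\<^sub>m n n}")
    case True
    then show ?thesis using I_zero by auto
  next
    case False
    then obtain A where A: "A \<in> I" "A \<noteq> 0\<^sub>m n n" by blast
    have Ac: "A \<in> carrier_mat n n" using A I supported_carrier by blast
    then obtain p q where pq: "p < n" "q < n" and nz: "coords A $$ (p, q) \<noteq> 0"
      using coords_eqI[OF Ac zero_carrier_mat] A(2) by (auto simp: coords_zero)
    have pq_class: "p \<in> c k" "q \<in> c k"
      using supportedD[of A "c k \<times> c k" p q] A I pq nz by auto
    \<comment> \<open>Dividing by the nonzero coordinate produces every multiple of every unit.\<close>
    have unit: "a \<cdot>\<^sub>m mat_unit r s \<in> I" if rs: "(r, s) \<in> c k \<times> c k" for r s a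
    proof -
      have in_R: "mat_unit x y \<in> carrier R" if "x \<in> c k" "y \<in> c k" for x y
        using that block_subset_blocks[OF k] by (auto intro: mat_unit_supported)
      have "(a / coords A $$ (p, q)) \<cdot>\<^sub>m mat_unit r p \<in> carrier R"
        using in_R rs pq_class by (auto intro!: smult_supported)
      then have "(a / coords A $$ (p, q)) \<cdot>\<^sub>m mat_unit r p * A * mat_unit q s \<in> I"
        using I.I_l_closed I.I_r_closed A(1) in_R rs pq_class by simp
      also have "(a / coords A $$ (p, q)) \<cdot>\<^sub>m mat_unit r p * A * mat_unit q s
          = (a / coords A $$ (p, q)) \<cdot>\<^sub>m (mat_unit r p * A * mat_unit q s)"
        using Ac by (simp add: square_mult_distrib)
      also have "\<dots> = a \<cdot>\<^sub>m mat_unit r s"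
        unfolding mat_unit_mult_mat_unit[OF Ac pq] by (rule eq_matI) (use nz in simp_all)
      finally show ?thesis .
    qed
    have "supported (c k \<times> c k) \<subseteq> I"
    proof
      fix B assume B: "B \<in> supported (c k \<times> c k)"
      show "B \<in> I"
      proof (rule supported_induct[OF B])
        show "c k \<times> c k \<subseteq> {..<n} \<times> {..<n}" using class_subset[OF k] by blast
      qed (use I_zero I_add unit in simp_all)
    qed
    then show ?thesis using I by blast
  qed
qed

text \<open>Restricting the coordinates to each class decomposes a matrix. The decomposition is unique since the
  coordinate of a sum at \<open>(p, q)\<close> sees only the summand of the class of \<open>p\<close>.\<close>

lemma blocks_direct_sum: "internal_direct_sum R K (\<lambda>k. supported (c k \<times> c k))"
  unfolding internal_direct_sum_def
proof (intro conjI ballI)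
  show "finite K" by (rule finite_K)
  show "additive_subgroup (supported (c k \<times> c k)) R" if "k \<in> K" for k
    using subgroup_supported block_subset_blocks that by blast
  fix A assume A: "A \<in> carrier R"
  have entry: "coords (finsum R x K) $$ (p, q) = (if q \<in> c k then coords (x k) $$ (p, q) else 0)"
    if x: "x \<in> (\<Pi>\<^sub>E k\<in>K. supported (c k \<times> c k))" and pq: "p < n" "q < n" and k: "k \<in> K" "p \<in> c k"
    for x p q k
  proof -
    have xf: "x \<in> K \<rightarrow> supported blocks"
      using x supported_mono[OF block_subset_blocks] by (auto simp: PiE_iff)
    have "coords (finsum R x K) $$ (p, q) = (\<Sum>l\<in>K. coords (x l) $$ (p, q))"
      by (rule coords_finsum[OF finite_K xf pq])
    also have "\<dots> = (\<Sum>l\<in>K. if l = k then (if q \<in> c k then coords (x k) $$ (p, q) else 0) else 0)"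
    proof (rule sum.cong[OF refl])
      fix l assume l: "l \<in> K"
      have xl: "x l \<in> supported (c l \<times> c l)" using x l by auto
      show "coords (x l) $$ (p, q) = (if l = k then (if q \<in> c k then coords (x k) $$ (p, q) else 0) else 0)"
        using supportedD[OF xl pq] disjoint[OF l k(1) _ k(2)] by auto
    qed
    finally show ?thesis using finite_K k by simp
  qed
  let ?x = "\<lambda>k\<in>K. from_coords (mat n n (\<lambda>(p, q). if p \<in> c k \<and> q \<in> c k then coords A $$ (p, q) else 0))"
  have x: "?x \<in> (\<Pi>\<^sub>E k\<in>K. supported (c k \<times> c k))"
    by (auto intro!: supportedI split: if_splits)
  have Rc: "finsum R x K \<in> carrier_mat n n" if "x \<in> (\<Pi>\<^sub>E k\<in>K. supported (c k \<times> c k))" for x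
  proof -
    interpret ring R by (rule ring_R)
    have "x \<in> K \<rightarrow> carrier R"
      using that supported_mono[OF block_subset_blocks] by (auto simp: PiE_iff)
    then have "finsum R x K \<in> carrier R" by (rule finsum_closed)
    then show ?thesis by (simp add: supported_carrier)
  qed
  show "\<exists>!x. x \<in> (\<Pi>\<^sub>E k\<in>K. supported (c k \<times> c k)) \<and> A = finsum R x K"
  proof (rule ex1I[of _ ?x])
    have "A = finsum R ?x K"
    proof (rule coords_eqI[OF _ Rc[OF x]])
      fix p q assume pq: "p < n" "q < n"
      then obtain k where k: "k \<in> K" "p \<in> c k" using cover by blast
      have "coords A $$ (p, q) = 0" if "q \<notin> c k"
        using supportedD[of A blocks p q] A pq blocks_classD[of p q k] k that by auto
      then show "coords A $$ (p, q) = coords (finsum R ?x K) $$ (p, q)"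
        using entry[OF x pq k] k pq by simp
    qed (use A supported_carrier in auto)
    then show "?x \<in> (\<Pi>\<^sub>E k\<in>K. supported (c k \<times> c k)) \<and> A = finsum R ?x K" using x by blast
  next
    fix y assume y: "y \<in> (\<Pi>\<^sub>E k\<in>K. supported (c k \<times> c k)) \<and> A = finsum R y K"
    show "y = ?x"
    proof (rule PiE_ext[OF conjunct1[OF y] x])
      fix k assume k: "k \<in> K"
      have yk: "y k \<in> supported (c k \<times> c k)" using y k by auto
      show "y k = ?x k"
      proof (rule coords_eqI)
        fix p q assume pq: "p < n" "q < n"
        show "coords (y k) $$ (p, q) = coords (?x k) $$ (p, q)"
          using entry[OF conjunct1[OF y] pq k] supportedD[OF yk pq] y k pq by auto
      qed (use yk k supported_carrier in auto)
    qed
  qed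
qed

end

section \<open>Roots of unity and the discrete Fourier transform\<close>

definition unit_root :: "nat \<Rightarrow> int \<Rightarrow> complex"
  where "unit_root n k = cis (2 * pi * real_of_int k / real n)"

lemma unit_root_add: "unit_root n (j + k) = unit_root n j * unit_root n k"
  by (simp add: unit_root_def cis_mult add_divide_distrib distrib_left)

lemma unit_root_0 [simp]: "unit_root n 0 = 1"
  by (simp add: unit_root_def)

lemma unit_root_eq_1_iff:
  assumes "n > 0"
  shows "unit_root n k = 1 \<longleftrightarrow> int n dvd k"
proof -
  let ?x = "2 * pi * real_of_int k / real n"
  have "unit_root n k = 1 \<longleftrightarrow> cos ?x = 1"
    using cos_one_sin_zero[of ?x] by (auto simp: unit_root_def complex_eq_iff)
  also have "\<dots> \<longleftrightarrow> (\<exists>m::int. ?x = 2 * pi * real_of_int m)"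
    unfolding cos_one_2pi_int by (simp add: mult_ac)
  also have "\<dots> \<longleftrightarrow> (\<exists>m::int. real_of_int k = real_of_int (int n * m))"
    using assms by (auto simp: field_simps)
  also have "\<dots> \<longleftrightarrow> int n dvd k"
    unfolding of_int_eq_iff by (auto simp: dvd_def)
  finally show ?thesis .
qed

lemma unit_root_cong:
  assumes "n > 0" "[j = k] (mod int n)"
  shows "unit_root n j = unit_root n k"
proof -
  have "unit_root n (j - k) = 1"
    using assms by (simp add: unit_root_eq_1_iff cong_iff_dvd_diff)
  then show ?thesis using unit_root_add[of n "j - k" k] by simp
qed

text \<open>Orthogonality of characters: a geometric sum with ratio \<open>\<omega>\<^sup>k\<close>, which is \<open>1\<close> exactly when \<open>n\<close>
  divides \<open>k\<close> and an \<open>n\<close>-th root of unity in any case.\<close>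

lemma sum_unit_root:
  assumes "n > 0"
  shows "(\<Sum>b<n. unit_root n (k * int b)) = (if int n dvd k then of_nat n else 0)"
proof -
  have power: "unit_root n (k * int b) = unit_root n k ^ b" for b
    by (induction b) (simp_all add: algebra_simps unit_root_add)
  show ?thesis
  proof (cases "int n dvd k")
    case True
    then have "unit_root n k = 1" using assms by (simp add: unit_root_eq_1_iff)
    then show ?thesis using True by (simp add: power)
  next
    case False
    have "unit_root n k ^ n = 1"
      using power[of n] assms unit_root_eq_1_iff[of n "k * int n"] by simp
    then show ?thesis
      using False assms geometric_sum[of "unit_root n k" n] by (simp add: power unit_root_eq_1_iff)
  qed
qed

definition dft :: "nat \<Rightarrow> complex mat"
  where "dft n = mat n n (\<lambda>(a, p). unit_root n (int a * int p))"

definition inverse_dft :: "nat \<Rightarrow> complex mat"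
  where "inverse_dft n = mat n n (\<lambda>(p, b). unit_root n (- (int p * int b)) / of_nat n)"

lemma dft_carrier: "dft n \<in> carrier_mat n n" "inverse_dft n \<in> carrier_mat n n"
  by (simp_all add: dft_def inverse_dft_def)

lemma dvd_diff_less_iff:
  assumes "i < n" "j < n"
  shows "int n dvd int i - int j \<longleftrightarrow> i = j"
  using assms by (metis cong_iff_dvd_diff cong_int_iff cong_less_modulus_unique_nat cong_refl)

lemma dvd_sum_less_iff:
  assumes "i < n" "j < n"
  shows "int n dvd int i + int j \<longleftrightarrow> i + j = n \<or> i = 0 \<and> j = 0"
proof
  assume "int n dvd int i + int j"
  then have "n dvd i + j" by (metis int_dvd_int_iff of_nat_add)
  then obtain m where m: "i + j = n * m" by (auto simp: dvd_def)
  have "i + j < n * 2" using assms by simp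
  then have "m < 2" unfolding m by simp
  then have "m = 0 \<or> m = 1" by auto
  then show "i + j = n \<or> i = 0 \<and> j = 0" using m by auto
next
  assume "i + j = n \<or> i = 0 \<and> j = 0"
  then show "int n dvd int i + int j" by (metis add_0 dvd_0_right dvd_refl of_nat_0 of_nat_add)
qed

section \<open>Frequency classes\<close>

text \<open>A class consists of a frequency modulo \<open>n\<close> and its negative, the two being exchanged by every
  reflection.\<close>

fun freq_class :: "nat \<Rightarrow> block \<Rightarrow> nat set"
  where
    "freq_class n Triv = {0}"
  | "freq_class n Alt = {n div 2}"
  | "freq_class n (Rot j) = {j, n - j}"

text \<open>One index set for both parities: for \<open>n = 2 m\<close> the bound \<open>(n - 1) div 2\<close> is \<open>m - 1\<close>.\<close>

definition block_index :: "nat \<Rightarrow> block set"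
  where "block_index n = (if even n then {Triv, Alt} else {Triv}) \<union> Rot ` {1..(n - 1) div 2}"

lemma finite_block_index: "finite (block_index n)"
  by (simp add: block_index_def)

section \<open>Dihedral permutations as affine maps\<close>

text \<open>The permutation is \<open>b \<mapsto> \<epsilon> b + k\<close> on residues modulo \<open>n\<close>, with labels \<open>1, \<dots>, n\<close>. The dihedral
  permutations are of this form with \<open>\<epsilon> = \<plusminus>1\<close>, and this form turns the Fourier coordinates of
  a permutation matrix into geometric sums.\<close>

definition affine_perm :: "nat \<Rightarrow> (nat \<Rightarrow> nat) \<Rightarrow> int \<Rightarrow> int \<Rightarrow> bool"
  where "affine_perm n \<sigma> \<epsilon> k \<longleftrightarrow> \<sigma> permutes {1..n} \<and>
    (\<forall>b\<in>{1..n}. [int (\<sigma> b) = \<epsilon> * int b + k] (mod int n))"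

lemma affine_perm_id: "affine_perm n id 1 0"
  by (auto simp: affine_perm_def permutes_id)

lemma affine_perm_comp:
  assumes \<sigma>: "affine_perm n \<sigma> \<epsilon> k" and \<tau>: "affine_perm n \<tau> \<delta> l"
  shows "affine_perm n (\<sigma> \<circ> \<tau>) (\<epsilon> * \<delta>) (\<epsilon> * l + k)"
  unfolding affine_perm_def
proof (intro conjI ballI)
  show "\<sigma> \<circ> \<tau> permutes {1..n}"
    using assms by (auto simp: affine_perm_def intro: permutes_compose)
  fix b assume b: "b \<in> {1..n}"
  then have "\<tau> b \<in> {1..n}" using \<tau> permutes_in_image unfolding affine_perm_def by metis
  then have "[int (\<sigma> (\<tau> b)) = \<epsilon> * int (\<tau> b) + k] (mod int n)"
    using \<sigma> by (simp add: affine_perm_def)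
  also have "[\<epsilon> * int (\<tau> b) + k = \<epsilon> * (\<delta> * int b + l) + k] (mod int n)"
    using \<tau> b by (intro cong_add cong_mult cong_refl) (simp add: affine_perm_def)
  finally show "[int ((\<sigma> \<circ> \<tau>) b) = \<epsilon> * \<delta> * int b + (\<epsilon> * l + k)] (mod int n)"
    by (simp add: algebra_simps)
qed

lemma affine_perm_inv:
  assumes \<sigma>: "affine_perm n \<sigma> \<epsilon> k" and \<epsilon>: "\<epsilon> * \<epsilon> = 1"
  shows "affine_perm n (inv' \<sigma>) \<epsilon> (- \<epsilon> * k)"
  unfolding affine_perm_def
proof (intro conjI ballI)
  have perm: "\<sigma> permutes {1..n}" using \<sigma> by (simp add: affine_perm_def)
  then show "inv' \<sigma> permutes {1..n}" by (rule permutes_inv)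
  fix b assume b: "b \<in> {1..n}"
  let ?a = "inv' \<sigma> b"
  have "?a \<in> {1..n}" using b permutes_in_image[OF permutes_inv[OF perm]] by metis
  then have "[int (\<sigma> ?a) = \<epsilon> * int ?a + k] (mod int n)" using \<sigma> by (simp add: affine_perm_def)
  then have "[\<epsilon> * (int b - k) = \<epsilon> * (\<epsilon> * int ?a + k - k)] (mod int n)"
    using permutes_inverses(1)[OF perm] by (intro cong_mult cong_diff cong_refl) simp
  also have "\<epsilon> * (\<epsilon> * int ?a + k - k) = int ?a" using \<epsilon> by (simp flip: mult.assoc)
  finally show "[int ?a = \<epsilon> * int b + - \<epsilon> * k] (mod int n)"
    by (simp add: cong_sym_eq algebra_simps)
qed

lemma rotation_apply:
  assumes "b \<in> {1..n}"
  shows "rotation n b = (if b = n then 1 else b + 1)"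
proof -
  let ?cs = "[1..<n + 1]"
  have "map (rotation n) ?cs = rotate 1 ?cs"
    using cyclic_rotation[of ?cs 1] by (simp add: rotation_def del: upt_Suc)
  then have "map (rotation n) ?cs ! (b - 1) = rotate 1 ?cs ! (b - 1)" by simp
  moreover have "map (rotation n) ?cs ! (b - 1) = rotation n b"
    using assms by (auto simp del: upt_Suc)
  moreover have "rotate 1 ?cs ! (b - 1) = ?cs ! (b mod n)"
    using assms by (subst nth_rotate) (auto simp del: upt_Suc)
  moreover have "?cs ! (b mod n) = 1 + b mod n"
    using assms by (subst nth_upt) auto
  ultimately show ?thesis using assms by auto
qed

lemma affine_perm_rotation: "affine_perm n (rotation n) 1 1"
  unfolding affine_perm_def
proof (intro conjI ballI)
  have "set [1..<n + 1] = {1..n}" by auto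
  then show "rotation n permutes {1..n}"
    using cycle_permutes[of "[1..<n + 1]"] by (simp add: rotation_def)
  fix b assume "b \<in> {1..n}"
  then show "[int (rotation n b) = 1 * int b + 1] (mod int n)"
    by (simp add: rotation_apply cong_iff_dvd_diff)
qed

lemma affine_perm_reflection: "affine_perm n (reflection n) (- 1) 1"
  unfolding affine_perm_def
proof (intro conjI ballI)
  have invol: "reflection n (reflection n b) = b" for b
    by (cases "b \<in> {1..n}") (auto simp: reflection_def)
  show "reflection n permutes {1..n}"
    unfolding permutes_def
  proof (intro conjI allI impI)
    show "reflection n b = b" if "b \<notin> {1..n}" for b
      using that unfolding reflection_def by (rule if_not_P)
    show "\<exists>!a. reflection n a = b" for b using invol by metis
  qed
  fix b assume "b \<in> {1..n}"
  then show "[int (reflection n b) = - 1 * int b + 1] (mod int n)"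
    by (auto simp: reflection_def cong_iff_dvd_diff of_nat_diff)
qed

lemma affine_perm_rotation_power: "affine_perm n (rotation n ^^ k) 1 (int k)"
proof (induction k)
  case 0
  then show ?case using affine_perm_id by (simp add: id_def)
next
  case (Suc k)
  then show ?case using affine_perm_comp[OF affine_perm_rotation Suc] by (simp add: add.commute comp_def)
qed

lemma dihedral_affine:
  assumes "\<sigma> \<in> dihedral n"
  shows "\<exists>\<epsilon>\<in>{1, - 1}. \<exists>k. affine_perm n \<sigma> \<epsilon> k"
  using assms unfolding dihedral_def
proof induction
  case one
  have "affine_perm n \<one>\<^bsub>sym_group n\<^esub> 1 0" using affine_perm_id by (simp add: sym_group_def)
  then show ?case by blast
next
  case (incl \<sigma>)
  then show ?case using affine_perm_rotation affine_perm_reflection by blast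
next
  case (inv \<sigma>)
  then obtain \<epsilon> k where \<sigma>: "\<epsilon> \<in> {1, - 1}" "affine_perm n \<sigma> \<epsilon> k"
    using affine_perm_rotation affine_perm_reflection by blast
  have "inv\<^bsub>sym_group n\<^esub> \<sigma> = inv' \<sigma>"
    using \<sigma>(2) by (intro sym_group_inv_equality) (simp add: affine_perm_def sym_group_carrier)
  then show ?case using affine_perm_inv[OF \<sigma>(2)] \<sigma>(1) by auto
next
  case (eng \<sigma> \<tau>)
  then obtain \<epsilon> k \<delta> l where st: "\<epsilon> \<in> {1, - 1}" "affine_perm n \<sigma> \<epsilon> k"
    "\<delta> \<in> {1, - 1}" "affine_perm n \<tau> \<delta> l" by blast
  then have "\<epsilon> * \<delta> \<in> {1, - 1}" by auto
  moreover have "affine_perm n (\<sigma> \<otimes>\<^bsub>sym_group n\<^esub> \<tau>) (\<epsilon> * \<delta>) (\<epsilon> * l + k)"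
    using affine_perm_comp[OF st(2,4)] by (simp add: sym_group_def)
  ultimately show ?case by blast
qed

lemma rotation_power_dihedral: "rotation n ^^ k \<in> dihedral n"
proof (induction k)
  case 0
  then show ?case using generate.one[of "sym_group n"] by (simp add: dihedral_def sym_group_def id_def)
next
  case (Suc k)
  then show ?case
    using generate.eng[OF generate.incl[of "rotation n" "{rotation n, reflection n}" "sym_group n"]]
    by (simp add: dihedral_def sym_group_def comp_def)
qed

lemma reflection_dihedral: "reflection n \<in> dihedral n"
  unfolding dihedral_def by (rule generate.incl) simp


section \<open>The algebra in Fourier coordinates\<close>

locale dihedral_matrices =
  fixes n :: nat
  assumes n_ge_3: "n \<ge> 3"
begin

lemma n_pos: "n > 0" using n_ge_3 by simp

lemma dft_inverse: "dft n * inverse_dft n = 1\<^sub>m n" "inverse_dft n * dft n = 1\<^sub>m n"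
proof -
  have orth: "(\<Sum>p<n. unit_root n ((int i - int j) * int p)) / of_nat n = (if i = j then 1 else 0)"
    if "i < n" "j < n" for i j
    using n_pos that by (simp add: sum_unit_root dvd_diff_less_iff)
  show "dft n * inverse_dft n = 1\<^sub>m n"
  proof (rule eq_matI)
    fix i j assume "i < dim_row (1\<^sub>m n :: complex mat)" "j < dim_col (1\<^sub>m n :: complex mat)"
    then have ij: "i < n" "j < n" by simp_all
    have "(dft n * inverse_dft n) $$ (i, j)
        = (\<Sum>p<n. unit_root n (int i * int p) * (unit_root n (- (int p * int j)) / of_nat n))"
      using ij by (simp add: dft_def inverse_dft_def scalar_prod_def atLeast0LessThan)
    also have "\<dots> = (\<Sum>p<n. unit_root n ((int i - int j) * int p)) / of_nat n"
      unfolding sum_divide_distrib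
      by (intro sum.cong refl) (simp add: algebra_simps flip: unit_root_add)
    finally show "(dft n * inverse_dft n) $$ (i, j) = 1\<^sub>m n $$ (i, j)"
      using orth[OF ij] ij by simp
  qed (simp_all add: dft_def inverse_dft_def)
  show "inverse_dft n * dft n = 1\<^sub>m n"
  proof (rule eq_matI)
    fix i j assume "i < dim_row (1\<^sub>m n :: complex mat)" "j < dim_col (1\<^sub>m n :: complex mat)"
    then have ij: "i < n" "j < n" by simp_all
    have "(inverse_dft n * dft n) $$ (i, j)
        = (\<Sum>p<n. unit_root n (- (int i * int p)) / of_nat n * unit_root n (int p * int j))"
      using ij by (simp add: dft_def inverse_dft_def scalar_prod_def atLeast0LessThan)
    also have "\<dots> = (\<Sum>p<n. unit_root n ((int j - int i) * int p)) / of_nat n"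
      unfolding sum_divide_distrib
      by (intro sum.cong refl) (simp add: algebra_simps flip: unit_root_add)
    finally show "(inverse_dft n * dft n) $$ (i, j) = 1\<^sub>m n $$ (i, j)"
      using orth[OF ij(2,1)] ij by auto
  qed (simp_all add: dft_def inverse_dft_def)
qed

text \<open>For \<open>h = (n - 1) div 2\<close>, a nonzero frequency is at most \<open>h\<close>, or its negative is, or \<open>n\<close> is twice
  the frequency.\<close>

lemma freq_class_cover: "(\<Union>k\<in>block_index n. freq_class n k) = {..<n}"
proof
  show "(\<Union>k\<in>block_index n. freq_class n k) \<subseteq> {..<n}"
    using n_pos by (auto simp: block_index_def)
  show "{..<n} \<subseteq> (\<Union>k\<in>block_index n. freq_class n k)"
  proof
    fix p assume p: "p \<in> {..<n}"
    define h where "h = (n - 1) div 2"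
    have "n = 2 * h + 1 \<or> even n \<and> n = 2 * (h + 1)"
      using n_pos unfolding h_def by presburger
    then have "n = 2 * h + 1 \<or> n = 2 * h + 2" by auto
    then have half: "n = 2 * p" if "\<not> p \<le> h" "\<not> n - p \<le> h"
      using that p unfolding lessThan_iff by linarith
    have index: "block_index n = (if even n then {Triv, Alt} else {Triv}) \<union> Rot ` {1..h}"
      by (simp only: block_index_def h_def)
    consider "p = 0" | "p \<noteq> 0" "p \<le> h" | "n - p \<le> h" | "n = 2 * p"
      using half by blast
    then show "p \<in> (\<Union>k\<in>block_index n. freq_class n k)"
    proof cases
      case 1
      then show ?thesis by (intro UN_I[of Triv]) (simp_all add: index)
    next
      case 2
      then show ?thesis by (intro UN_I[of "Rot p"]) (simp_all add: index)
    next
      case 3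
      then show ?thesis using p by (intro UN_I[of "Rot (n - p)"]) (simp_all add: index)
    next
      case 4
      then have "even n" "p = n div 2" by simp_all
      then show ?thesis by (intro UN_I[of Alt]) (simp_all add: index)
    qed
  qed
qed

sublocale block_algebra n "dft n" "inverse_dft n" "block_index n" "freq_class n"
proof
  show "k = l" if "k \<in> block_index n" "l \<in> block_index n" "p \<in> freq_class n k" "p \<in> freq_class n l"
    for k l p
  proof -
    define h where "h = (n - 1) div 2"
    have "2 * h < n" using n_pos by (auto simp: h_def)
    moreover from this have "h < n div 2" if "even n" using that by presburger
    ultimately show ?thesis
      using that unfolding block_index_def h_def[symmetric] by (auto split: if_splits)
  qed
qed (simp_all add: dft_inverse freq_class_cover dft_carrier finite_block_index)

lemma blocks_iff: "(p, q) \<in> blocks \<longleftrightarrow> p < n \<and> q < n \<and> (p = q \<or> p + q = n)"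
proof
  assume pq: "(p, q) \<in> blocks"
  then obtain k where k: "k \<in> block_index n" "p \<in> freq_class n k" "q \<in> freq_class n k"
    unfolding blocks_def by blast
  then have "p = q \<or> p + q = n"
    by (cases k) (auto simp: block_index_def split: if_splits)
  then show "p < n \<and> q < n \<and> (p = q \<or> p + q = n)"
    using pq blocks_subset by auto
next
  assume pq: "p < n \<and> q < n \<and> (p = q \<or> p + q = n)"
  then obtain k where k: "k \<in> block_index n" "p \<in> freq_class n k" using cover by blast
  have "q \<in> freq_class n k"
    using pq k by (cases k) (auto simp: block_index_def split: if_splits)
  then show "(p, q) \<in> blocks" using k by (auto simp: blocks_def)
qed

lemma card_blocks_dihedral: "card blocks = (if even n then 2 else 1) + 4 * ((n - 1) div 2)"
proof -
  have rot: "(\<Sum>k\<in>Rot ` {1..(n - 1) div 2}. card (freq_class n k) ^ 2) = 4 * ((n - 1) div 2)"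
  proof -
    have "card {j, n - j} = 2" if "j \<in> {1..(n - 1) div 2}" for j
    proof -
      have "j \<noteq> n - j" using that by auto
      then show ?thesis by simp
    qed
    then have "(\<Sum>j=1..(n - 1) div 2. card (freq_class n (Rot j)) ^ 2) = (\<Sum>j=1..(n - 1) div 2. 4)"
      by (intro sum.cong) simp_all
    then show ?thesis by (subst sum.reindex) (auto simp: inj_on_def)
  qed
  have "(\<Sum>k\<in>block_index n. card (freq_class n k) ^ 2) = (if even n then 2 else 1) + 4 * ((n - 1) div 2)"
    unfolding block_index_def
    by (subst sum.union_disjoint) (auto simp: rot[simplified])
  then show ?thesis by (simp add: card_blocks)
qed

lemma index_mat_unit:
  assumes "a < n" "b < n" "p < n" "q < n"
  shows "mat_unit p q $$ (a, b) = unit_root n (int a * int p - int q * int b) / of_nat n"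
proof -
  let ?E = "mat n n (\<lambda>ij. if ij = (p, q) then 1 else 0) :: complex mat"
  have "mat_unit p q $$ (a, b) = (\<Sum>j<n. (\<Sum>i<n. dft n $$ (a, i) * ?E $$ (i, j)) * inverse_dft n $$ (j, b))"
    using assms unfolding mat_unit_def from_coords_def
    by (simp add: dft_def inverse_dft_def scalar_prod_def
        atLeast0LessThan del: assoc_mult_mat)
  also have "\<dots> = (\<Sum>j<n. if j = q then dft n $$ (a, p) * inverse_dft n $$ (q, b) else 0)"
  proof (intro sum.cong refl)
    fix j assume "j \<in> {..<n}"
    then have "(\<Sum>i<n. dft n $$ (a, i) * ?E $$ (i, j))
        = (\<Sum>i<n. if i = p then if j = q then dft n $$ (a, p) else 0 else 0)"
      by (intro sum.cong refl) auto
    then show "(\<Sum>i<n. dft n $$ (a, i) * ?E $$ (i, j)) * inverse_dft n $$ (j, b)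
        = (if j = q then dft n $$ (a, p) * inverse_dft n $$ (q, b) else 0)"
      using assms by simp
  qed
  also have "\<dots> = dft n $$ (a, p) * inverse_dft n $$ (q, b)"
    using assms by simp
  also have "\<dots> = unit_root n (int a * int p - int q * int b) / of_nat n"
    using assms by (simp add: dft_def inverse_dft_def flip: unit_root_add)
  finally show ?thesis .
qed

lemma perm_mat_carrier [simp]: "perm_mat n \<sigma> \<in> carrier_mat n n"
  by (simp add: perm_mat_def)

text \<open>For \<open>\<epsilon> = \<plusminus>1\<close>, the matrix of \<open>b \<mapsto> \<epsilon> b + k\<close> sends the character of frequency \<open>q\<close> to a
  multiple of the character of frequency \<open>\<epsilon> q\<close>, and orthogonality kills all other coordinates. The phase carries \<open>\<epsilon> + k - 1\<close>
  rather than \<open>k\<close> because matrix positions count from \<open>0\<close> and labels from \<open>1\<close>.\<close>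

lemma coords_perm_mat:
  assumes \<sigma>: "affine_perm n \<sigma> \<epsilon> k" and pq: "p < n" "q < n"
  shows "coords (perm_mat n \<sigma>) $$ (p, q) =
    (if int n dvd int q - \<epsilon> * int p then unit_root n (- int p * (\<epsilon> + k - 1)) else 0)"
proof -
  have \<sigma>_bound: "1 \<le> \<sigma> (j + 1) \<and> \<sigma> (j + 1) \<le> n" if "j < n" for j
  proof -
    have "j + 1 \<in> {1..n}" using that by simp
    then have "\<sigma> (j + 1) \<in> {1..n}"
      using \<sigma> permutes_in_image unfolding affine_perm_def by metis
    then show ?thesis by simp
  qed
  \<comment> \<open>Column \<open>j\<close> of the permutation matrix has its only entry in row \<open>\<sigma> (j + 1) - 1\<close>.\<close>
  have column: "(\<Sum>i<n. inverse_dft n $$ (p, i) * perm_mat n \<sigma> $$ (i, j)) * dft n $$ (j, q)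
      = unit_root n (- int p * (\<epsilon> + k - 1)) * (unit_root n ((int q - \<epsilon> * int p) * int j) / of_nat n)"
    if j: "j < n" for j
  proof -
    let ?i = "\<sigma> (j + 1) - 1"
    have i: "?i < n" "int ?i = int (\<sigma> (j + 1)) - 1" using \<sigma>_bound[OF j] n_pos by auto
    have "(\<Sum>i<n. inverse_dft n $$ (p, i) * perm_mat n \<sigma> $$ (i, j))
        = (\<Sum>i<n. if i = ?i then inverse_dft n $$ (p, i) else 0)"
      by (intro sum.cong refl) (use j \<sigma>_bound[OF j] in \<open>auto simp: perm_mat_def\<close>)
    also have "\<dots> = unit_root n (- (int p * int ?i)) / of_nat n"
      using i(1) pq by (simp add: inverse_dft_def)
    finally have "(\<Sum>i<n. inverse_dft n $$ (p, i) * perm_mat n \<sigma> $$ (i, j)) * dft n $$ (j, q)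
        = unit_root n (- (int p * int ?i) + int j * int q) / of_nat n"
      using j pq unit_root_add[of n "- (int p * int ?i)" "int j * int q"] by (simp add: dft_def)
    also have "unit_root n (- (int p * int ?i) + int j * int q)
        = unit_root n (- int p * (\<epsilon> * (int j + 1) + k - 1) + int j * int q)"
    proof (rule unit_root_cong[OF n_pos])
      have "j + 1 \<in> {1..n}" using j by simp
      then have "[int (\<sigma> (j + 1)) = \<epsilon> * int (j + 1) + k] (mod int n)"
        using \<sigma> unfolding affine_perm_def by blast
      then have "[- int p * (int (\<sigma> (j + 1)) - 1) + int j * int q
          = - int p * (\<epsilon> * int (j + 1) + k - 1) + int j * int q] (mod int n)"
        by (intro cong_add cong_mult cong_diff cong_refl)
      then show "[- (int p * int ?i) + int j * int q
          = - int p * (\<epsilon> * (int j + 1) + k - 1) + int j * int q] (mod int n)"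
        unfolding i(2) by (simp add: algebra_simps)
    qed
    also have "- int p * (\<epsilon> * (int j + 1) + k - 1) + int j * int q
        = - int p * (\<epsilon> + k - 1) + (int q - \<epsilon> * int p) * int j"
      by (simp add: algebra_simps)
    finally show ?thesis by (simp only: unit_root_add times_divide_eq_right)
  qed
  have "coords (perm_mat n \<sigma>) $$ (p, q)
      = (\<Sum>j<n. (\<Sum>i<n. inverse_dft n $$ (p, i) * perm_mat n \<sigma> $$ (i, j)) * dft n $$ (j, q))"
    using pq unfolding coords_def by (simp add: perm_mat_def dft_def inverse_dft_def scalar_prod_def
        atLeast0LessThan del: assoc_mult_mat)
  also have "\<dots> = unit_root n (- int p * (\<epsilon> + k - 1)) *
      ((\<Sum>j<n. unit_root n ((int q - \<epsilon> * int p) * int j)) / of_nat n)"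
    by (simp add: column sum_distrib_left sum_divide_distrib)
  finally show ?thesis using n_pos by (simp add: sum_unit_root)
qed

lemma coords_rotation_power:
  assumes "p < n" "q < n"
  shows "coords (perm_mat n (rotation n ^^ k)) $$ (p, q)
    = (if p = q then unit_root n (- int p * int k) else 0)"
  using assms by (auto simp: coords_perm_mat[OF affine_perm_rotation_power] dvd_diff_less_iff)

lemma coords_reflection:
  assumes "p < n" "q < n"
  shows "coords (perm_mat n (reflection n)) $$ (p, q)
    = (if p + q = n \<or> p = 0 \<and> q = 0 then unit_root n (int p) else 0)"
  using assms dvd_sum_less_iff[of q n p] by (auto simp: coords_perm_mat[OF affine_perm_reflection] add.commute)

lemma perm_mat_supported:
  assumes "\<sigma> \<in> dihedral n"
  shows "perm_mat n \<sigma> \<in> supported blocks"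
proof (rule supportedI)
  fix p q assume pq: "p < n" "q < n" "(p, q) \<notin> blocks"
  obtain \<epsilon> k where \<epsilon>: "\<epsilon> \<in> {1, - 1}" and \<sigma>: "affine_perm n \<sigma> \<epsilon> k"
    using dihedral_affine[OF assms] by blast
  have "\<not> int n dvd int q - \<epsilon> * int p"
    using \<epsilon> pq dvd_diff_less_iff[of q n p] dvd_sum_less_iff[of q n p] by (auto simp: blocks_iff)
  then show "coords (perm_mat n \<sigma>) $$ (p, q) = 0"
    using coords_perm_mat[OF \<sigma>] pq by simp
qed simp

lemma mat_alg_gen_subset: "mat_alg_gen n (perm_mat n ` dihedral n) \<subseteq> supported blocks"
proof
  fix A assume "A \<in> mat_alg_gen n (perm_mat n ` dihedral n)"
  then show "A \<in> supported blocks"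
  proof induction
    case one
    then show ?case by (simp add: one_supported blocks_refl)
  next
    case (mult A B)
    then show ?case using blocks_trans by (auto intro: mult_supported)
  qed (auto intro: perm_mat_supported smult_supported add_supported)
qed

text \<open>Averaging the powers of the rotation against the character of frequency \<open>p\<close> projects onto the
  eigenspace of the rotation for that frequency.\<close>

lemma mat_unit_diag_in:
  assumes p: "p < n"
  shows "mat_unit p p \<in> mat_alg_gen n (perm_mat n ` dihedral n)" (is "_ \<in> ?T")
proof -
  interpret ring R by (rule ring_R)
  let ?f = "\<lambda>k. (unit_root n (int p * int k) / of_nat n) \<cdot>\<^sub>m perm_mat n (rotation n ^^ k)"
  have f: "?f k \<in> ?T" for k
    using rotation_power_dihedral by (intro mat_alg_gen.smult mat_alg_gen.incl) simp
  then have f_R: "?f \<in> A \<rightarrow> supported blocks" for A using mat_alg_gen_subset by blast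
  have zero: "0\<^sub>m n n \<in> ?T"
  proof -
    have "0 \<cdot>\<^sub>m 1\<^sub>m n \<in> ?T" by (intro mat_alg_gen.smult mat_alg_gen.one)
    also have "0 \<cdot>\<^sub>m 1\<^sub>m n = (0\<^sub>m n n :: complex mat)" by (rule eq_matI) auto
    finally show ?thesis .
  qed
  have "finsum R ?f A \<in> ?T" if "finite A" for A
    using that
  proof induction
    case empty
    then show ?case using zero by simp
  next
    case (insert k A)
    then have "finsum R ?f (insert k A) = ?f k + finsum R ?f A"
      using finsum_insert[of A k ?f] f_R[of A] f_R[of "{k}"] by simp
    then show ?case using mat_alg_gen.add[OF f insert.IH] by simp
  qed
  then have "finsum R ?f {..<n} \<in> ?T" by simp
  also have "finsum R ?f {..<n} = mat_unit p p"
  proof (rule coords_eqI)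
    have "finsum R ?f {..<n} \<in> carrier R" by (rule finsum_closed) (use f_R in simp)
    then show "finsum R ?f {..<n} \<in> carrier_mat n n" by (simp add: supported_carrier)
    fix i j assume ij: "i < n" "j < n"
    have "coords (finsum R ?f {..<n}) $$ (i, j) = (\<Sum>k<n. coords (?f k) $$ (i, j))"
      using coords_finsum[OF _ f_R ij] by simp
    also have "\<dots> = (\<Sum>k<n. if i = j then unit_root n ((int p - int i) * int k) / of_nat n else 0)"
      by (intro sum.cong refl)
        (use ij in \<open>auto simp: index_coords_smult coords_rotation_power algebra_simps simp flip: unit_root_add\<close>)
    also have "\<dots> = coords (mat_unit p p) $$ (i, j)"
      using ij p n_pos
      by (cases "i = j")
        (auto simp: index_coords_mat_unit sum_unit_root dvd_diff_less_iff simp flip: sum_divide_distrib)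
    finally show "coords (finsum R ?f {..<n}) $$ (i, j) = coords (mat_unit p p) $$ (i, j)" .
  qed simp
  finally show ?thesis .
qed

text \<open>The reflection exchanges the frequencies \<open>p\<close> and \<open>q = n - p\<close>, so multiplying the diagonal unit at
  \<open>p\<close> by it leaves only the position \<open>(p, q)\<close>, up to a phase.\<close>

lemma mat_unit_block_in:
  assumes pq: "(p, q) \<in> blocks"
  shows "mat_unit p q \<in> mat_alg_gen n (perm_mat n ` dihedral n)" (is "_ \<in> ?T")
proof (cases "p = q")
  case True
  then show ?thesis using mat_unit_diag_in pq by (simp add: blocks_iff)
next
  case False
  then have n: "p < n" "q < n" "p + q = n" using pq by (auto simp: blocks_iff)
  let ?C = "perm_mat n (reflection n)"
  have "unit_root n (- int p) \<cdot>\<^sub>m (mat_unit p p * ?C) \<in> ?T"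
    using mat_alg_gen.smult[OF mat_alg_gen.mult[OF mat_unit_diag_in[OF n(1)] mat_alg_gen.incl]]
      reflection_dihedral by simp
  also have "unit_root n (- int p) \<cdot>\<^sub>m (mat_unit p p * ?C) = mat_unit p q"
  proof (rule coords_eqI)
    fix i j assume ij: "i < n" "j < n"
    have "coords (mat_unit p p * ?C) $$ (i, j)
        = (\<Sum>r<n. if r = p then (if i = p \<and> j = q then unit_root n (int p) else 0) else 0)"
      unfolding index_coords_mult[OF mat_unit_carrier perm_mat_carrier ij]
      by (intro sum.cong refl) (use ij n False in \<open>auto simp: index_coords_mat_unit coords_reflection\<close>)
    then show "coords (unit_root n (- int p) \<cdot>\<^sub>m (mat_unit p p * ?C)) $$ (i, j) = coords (mat_unit p q) $$ (i, j)"
      using ij n by (auto simp: index_coords_smult index_coords_mat_unit simp flip: unit_root_add)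
  qed simp_all
  finally show ?thesis .
qed

lemma mat_alg_gen_dihedral: "mat_alg_gen n (perm_mat n ` dihedral n) = supported blocks"
proof
  show "mat_alg_gen n (perm_mat n ` dihedral n) \<subseteq> supported blocks" by (rule mat_alg_gen_subset)
  show "supported blocks \<subseteq> mat_alg_gen n (perm_mat n ` dihedral n)" (is "_ \<subseteq> ?T")
  proof
    fix A assume A: "A \<in> supported blocks"
    show "A \<in> ?T"
    proof (rule supported_induct[OF A blocks_subset])
      have "0 \<cdot>\<^sub>m mat_unit 0 0 \<in> ?T"
        using mat_unit_diag_in[OF n_pos] by (rule mat_alg_gen.smult)
      also have "0 \<cdot>\<^sub>m mat_unit 0 0 = 0\<^sub>m n n"
        by (rule eq_matI) (use carrier_matD[OF mat_unit_carrier] in auto)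
      finally show "0\<^sub>m n n \<in> ?T" .
    qed (use mat_unit_block_in in \<open>auto intro: mat_alg_gen.intros\<close>)
  qed
qed

section \<open>Identification of the blocks\<close>

lemma MM_eq: "MM n = R"
  by (simp add: MM_def supp_alg_def mat_alg_gen_dihedral)

lemma range_scaled_mat_unit:
  assumes "A = d \<cdot>\<^sub>m mat_unit p q" "d \<noteq> 0"
  shows "range (\<lambda>c. c \<cdot>\<^sub>m A) = supported {(p, q)}"
proof -
  have A: "c \<cdot>\<^sub>m A = (c * d) \<cdot>\<^sub>m mat_unit p q" for c
    unfolding assms(1) by (rule eq_matI) auto
  have mat_unit: "c \<cdot>\<^sub>m mat_unit p q = (c / d) \<cdot>\<^sub>m A" for c
    using assms(2) by (simp add: A)
  have "range (\<lambda>c. c \<cdot>\<^sub>m A) = range (\<lambda>c. c \<cdot>\<^sub>m mat_unit p q)"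
  proof (intro equalityI image_subsetI)
    show "c \<cdot>\<^sub>m A \<in> range (\<lambda>c. c \<cdot>\<^sub>m mat_unit p q)" for c
      unfolding A by (rule rangeI)
    show "c \<cdot>\<^sub>m mat_unit p q \<in> range (\<lambda>c. c \<cdot>\<^sub>m A)" for c
      by (rule range_eqI[where x = "c / d"]) (rule mat_unit)
  qed
  then show ?thesis by (simp only: supported_singleton)
qed

lemma MM_block_Triv: "MM_block n Triv = supported (freq_class n Triv \<times> freq_class n Triv)"
proof -
  have "mat_J n = of_nat n \<cdot>\<^sub>m mat_unit 0 0"
    by (rule eq_matI)
      (use n_pos carrier_matD[OF mat_unit_carrier] in \<open>auto simp: mat_J_def index_mat_unit\<close>)
  then show ?thesis using range_scaled_mat_unit[of _ "of_nat n" 0 0] n_pos by simp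
qed

lemma unit_root_half:
  assumes "even n"
  shows "unit_root n (int (n div 2) * k) = (- 1) ^ nat \<bar>k\<bar>"
proof -
  have "2 * pi * real_of_int (int (n div 2) * k) / real n = pi * real_of_int k"
    using assms n_pos by (auto simp: real_of_nat_div field_simps)
  then have "unit_root n (int (n div 2) * k) = cis (pi * real_of_int k)"
    by (simp add: unit_root_def)
  then show ?thesis
    by (cases "even k") (auto simp: complex_eq_iff cos_int_times_real sin_int_times_real even_nat_iff mult.commute)
qed

lemma MM_block_Alt:
  assumes "even n"
  shows "MM_block n Alt = supported (freq_class n Alt \<times> freq_class n Alt)"
proof -
  have half: "n div 2 < n" using n_pos by simp
  have "U_alt n = 1 \<cdot>\<^sub>m mat_unit (n div 2) (n div 2)"
  proof (rule eq_matI)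
    fix a b assume "a < dim_row (1 \<cdot>\<^sub>m mat_unit (n div 2) (n div 2))"
      "b < dim_col (1 \<cdot>\<^sub>m mat_unit (n div 2) (n div 2))"
    then have ab: "a < n" "b < n" using carrier_matD[OF mat_unit_carrier] by auto
    have "unit_root n (int a * int (n div 2) - int (n div 2) * int b)
        = unit_root n (int (n div 2) * (int a - int b))" by (simp add: algebra_simps)
    also have "\<dots> = (- 1) ^ nat \<bar>int a - int b\<bar>" by (rule unit_root_half[OF assms])
    also have "\<dots> = (- 1) ^ ((a + 1) + (b + 1))"
    proof -
      have "even (nat \<bar>int a - int b\<bar>) \<longleftrightarrow> even ((a + 1) + (b + 1))"
        by (simp add: even_nat_iff)
      then show ?thesis by (simp only: minus_one_power_iff)
    qed
    finally show "U_alt n $$ (a, b) = (1 \<cdot>\<^sub>m mat_unit (n div 2) (n div 2)) $$ (a, b)"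
      using ab half carrier_matD[OF mat_unit_carrier] by (simp add: U_alt_def index_mat_unit)
  qed (use carrier_matD[OF mat_unit_carrier] in \<open>auto simp: U_alt_def\<close>)
  then show ?thesis using range_scaled_mat_unit[of _ 1] by simp
qed

text \<open>Writing \<open>2 cos x\<close> as a sum of two conjugate exponentials turns the defining sum into the two
  averages that project onto the frequencies \<open>j\<close> and \<open>-j\<close>.\<close>

lemma coords_U_rot:
  assumes j: "j \<in> {1..(n - 1) div 2}" and pq: "p < n" "q < n"
  shows "U_rot n j \<in> carrier_mat n n"
    and "coords (U_rot n j) $$ (p, q) = (if p = q \<and> p \<in> freq_class n (Rot j) then 1 else 0)"
proof -
  have "supported UNIV = carrier_mat n n" by (auto simp: supported_def)
  then have full: "module_mat TYPE(complex) n n = supp_alg UNIV"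
    by (simp add: supp_alg_def module_mat_def)
  let ?c = "\<lambda>k. complex_of_real (cos (2 * real k * real j * pi / real n))"
  let ?f = "\<lambda>k. ?c k \<cdot>\<^sub>m perm_mat n (rotation n ^^ k)"
  have f: "?f \<in> {0..<n} \<rightarrow> supported UNIV" by (auto simp: supported_def)
  interpret full: abelian_group "supp_alg UNIV" by (rule abelian_group_supp_alg)
  have sum_carrier: "finsum (supp_alg UNIV) ?f {0..<n} \<in> carrier_mat n n"
    using full.finsum_closed[of ?f "{0..<n}"] f by (simp add: supported_carrier)
  then show "U_rot n j \<in> carrier_mat n n" by (simp add: U_rot_def full)
  have cos: "2 * ?c k = unit_root n (int j * int k) + unit_root n (- (int j * int k))" for k
    by (simp add: unit_root_def complex_eq_iff mult_ac)
  have "coords (U_rot n j) $$ (p, q)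
      = complex_of_real (2 / real n) * (\<Sum>k\<in>{0..<n}. coords (?f k) $$ (p, q))"
    unfolding U_rot_def full index_coords_smult[OF sum_carrier pq] coords_finsum[OF finite_atLeastLessThan f pq] ..
  also have "\<dots> = (\<Sum>k<n. (2 * ?c k) * (if p = q then unit_root n (- int p * int k) else 0) / of_nat n)"
    unfolding sum_distrib_left atLeast0LessThan
    by (intro sum.cong refl) (use pq in \<open>simp add: index_coords_smult coords_rotation_power\<close>)
  also have "\<dots> = (\<Sum>k<n. if p = q then (unit_root n ((int j - int p) * int k)
      + unit_root n (- (int j + int p) * int k)) / of_nat n else 0)"
  proof (intro sum.cong refl)
    fix k
    have "unit_root n ((int j - int p) * int k) = unit_root n (int j * int k) * unit_root n (- int p * int k)"
      "unit_root n (- (int j + int p) * int k) = unit_root n (- (int j * int k)) * unit_root n (- int p * int k)"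
      by (simp_all add: algebra_simps flip: unit_root_add)
    then show "2 * ?c k * (if p = q then unit_root n (- int p * int k) else 0) / of_nat n
        = (if p = q then (unit_root n ((int j - int p) * int k)
          + unit_root n (- (int j + int p) * int k)) / of_nat n else 0)"
      by (cases "p = q") (simp_all only: cos distrib_right if_True if_False mult_zero_right div_0 simp_thms)
  qed
  also have "\<dots> = (if p = q then ((\<Sum>k<n. unit_root n ((int j - int p) * int k))
      + (\<Sum>k<n. unit_root n (- (int j + int p) * int k))) / of_nat n else 0)"
    by (simp add: add_divide_distrib sum.distrib sum_divide_distrib)
  also have "\<dots> = (if p = q \<and> p \<in> freq_class n (Rot j) then 1 else 0)"
  proof -
    have bounds: "j < n" "j \<noteq> n - j" "j \<noteq> 0" using j by auto
    have minus: "int n dvd int j - int p \<longleftrightarrow> p = j"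
      unfolding dvd_diff_less_iff[OF bounds(1) pq(1)] by (rule eq_commute)
    have "int n dvd - (int j + int p) \<longleftrightarrow> j + p = n"
      unfolding dvd_minus_iff dvd_sum_less_iff[OF bounds(1) pq(1)] using bounds(3) by simp
    also have "\<dots> \<longleftrightarrow> p = n - j" using bounds(1) by linarith
    finally have plus: "int n dvd - (int j + int p) \<longleftrightarrow> p = n - j" .
    show ?thesis
      unfolding sum_unit_root[OF n_pos] minus plus using bounds(2) n_pos by simp
  qed
  finally show "coords (U_rot n j) $$ (p, q) = (if p = q \<and> p \<in> freq_class n (Rot j) then 1 else 0)" .
qed

lemma MM_block_eq:
  assumes "k \<in> block_index n"
  shows "MM_block n k = supported (freq_class n k \<times> freq_class n k)"
proof (cases k)
  case Triv
  then show ?thesis using MM_block_Triv by simp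
next
  case Alt
  then show ?thesis using MM_block_Alt assms by (auto simp: block_index_def split: if_splits)
next
  case (Rot j)
  then have "j \<in> {1..(n - 1) div 2}" using assms by (auto simp: block_index_def split: if_splits)
  then show ?thesis
    using block_principal[OF assms coords_U_rot(1)[OF _ n_pos n_pos]] coords_U_rot(2) Rot
    by (simp add: MM_eq)
qed

theorem MM_decomposition:
  "internal_direct_sum (MM n) (block_index n) (MM_block n)"
  "k \<in> block_index n \<Longrightarrow> simple_ideal (MM_block n k) (MM n)"
  "vectorspace.fin_dim class_ring (MM n)"
  "vectorspace.dim class_ring (MM n) = (if even n then 2 else 1) + 4 * ((n - 1) div 2)"
proof -
  have "internal_direct_sum R (block_index n) (MM_block n)
      = internal_direct_sum R (block_index n) (\<lambda>k. supported (freq_class n k \<times> freq_class n k))"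
    unfolding internal_direct_sum_def using MM_block_eq by (simp cong: PiE_cong)
  then show "internal_direct_sum (MM n) (block_index n) (MM_block n)"
    using blocks_direct_sum by (simp add: MM_eq)
  show "simple_ideal (MM_block n k) (MM n)" if "k \<in> block_index n"
  proof -
    have "freq_class n k \<noteq> {}" by (cases k) simp_all
    then show ?thesis using block_simple[OF that] MM_block_eq[OF that] by (simp add: MM_eq)
  qed
  show "vectorspace.fin_dim class_ring (MM n)"
    unfolding MM_eq by (rule dim_supp_alg(1)[OF blocks_subset])
  show "vectorspace.dim class_ring (MM n) = (if even n then 2 else 1) + 4 * ((n - 1) div 2)"
    unfolding MM_eq dim_supp_alg(2)[OF blocks_subset] by (rule card_blocks_dihedral)
qed

end

theorem corollary4:
  fixes n :: nat
  assumes "n \<ge> 3"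
  shows "(odd n \<longrightarrow>
      internal_direct_sum (MM n) ({Triv} \<union> Rot ` {1..(n - 1) div 2}) (MM_block n) \<and>
      (\<forall>k \<in> {Triv} \<union> Rot ` {1..(n - 1) div 2}. simple_ideal (MM_block n k) (MM n)) \<and>
      vectorspace.fin_dim class_ring (MM n) \<and>
      vectorspace.dim class_ring (MM n) = 2 * n - 1) \<and>
    (\<forall>m. n = 2 * m \<longrightarrow>
      internal_direct_sum (MM n) ({Triv, Alt} \<union> Rot ` {1..m - 1}) (MM_block n) \<and>
      (\<forall>k \<in> {Triv, Alt} \<union> Rot ` {1..m - 1}. simple_ideal (MM_block n k) (MM n)) \<and>
      vectorspace.fin_dim class_ring (MM n) \<and>
      vectorspace.dim class_ring (MM n) = 2 * n - 2)"
proof -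
  interpret dihedral_matrices n by unfold_locales (rule assms)
  have "block_index n = {Triv} \<union> Rot ` {1..(n - 1) div 2}"
    "(if even n then 2 else 1) + 4 * ((n - 1) div 2) = 2 * n - 1" if "odd n"
    using that by (auto simp: block_index_def elim: oddE)
  moreover have "block_index n = {Triv, Alt} \<union> Rot ` {1..m - 1}"
    "(if even n then 2 else 1) + 4 * ((n - 1) div 2) = 2 * n - 2" if "n = 2 * m" for m
  proof -
    have "(n - 1) div 2 = m - 1" using that assms by simp
    then show "block_index n = {Triv, Alt} \<union> Rot ` {1..m - 1}"
      "(if even n then 2 else 1) + 4 * ((n - 1) div 2) = 2 * n - 2"
      using that assms by (auto simp: block_index_def)
  qed
  ultimately show ?thesis using MM_decomposition by metis
qed

end
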